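(* The proof system D-IR-calc is refutationally complete for DQBF: for every false DQBF $\Pi\cdot\psi$ whose matrix $\psi$ is in CNF, there is a D-IR-calc derivation of the empty clause $\bot$ from $\Pi\cdot\psi$.
   Context: A DQBF $\Pi\cdot\psi$ has universal variables $Y$, existential variables $X$, and for each $x\in X$ a dependency set $Y_x\subseteq Y$; $\psi$ is a CNF over $X\cup Y$ (clauses are sets of literals). It is true iff there are Skolem functions $f_x:\{0,1\}^{Y_x}\to\{0,1\}$ ($x\in X$) such that for every $\alpha:Y\to\{0,1\}$, $\psi$ evaluates to $1$ under $\alpha$ extended by $x\mapsto f_x(\alpha\restriction Y_x)$; otherwise it is false. An annotated literal is $l^\tau$ where $l$ is a literal on an existential variable $x$ and $\tau$ is a partial assignment of variables in $Y_x$ to $\{0,1\}$. For a partial assignment $\tau$ of $Y$ and $x\in X$, $\mathrm{restrict}_x(\tau)$ is $\tau$ restricted to $\mathrm{dom}(\tau)\cap Y_x$. For a clause $C$ of annotated literals and partial assignment $\tau$ of universal variables, $\mathrm{instantiate}_\tau(C)$ is the clause of all $l^{\mathrm{restrict}_{\mathrm{var}(l)}(\sigma)}$ for $l^\xi\in C$, where $\mathrm{dom}(\sigma)=\mathrm{dom}(\xi)\cup\mathrm{dom}(\tau)$, $\sigma(u)=\xi(u)$ for $u\in\mathrm{dom}(\xi)$ and $\sigma(u)=\tau(u)$ otherwise. D-IR-calc derives clauses of annotated literals with the rules: (Axiom) from a non-tautological clause $C$ of $\psi$, derive $\{l^{\mathrm{restrict}_{\mathrm{var}(l)}(\tau)}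 : l\in C,\ \mathrm{var}(l)\in X\}$, where $\tau$ maps each universal variable $u$ occurring in $C$ to $0$ if the literal $u$ occurs in $C$ and to $1$ if $\neg u$ occurs in $C$; (Resolution) from $\{x^\tau\}\cup C_1$ and $\{\neg x^\tau\}\cup C_2$ derive $C_1\cup C_2$; (Instantiation) from $C$ derive $\mathrm{instantiate}_\tau(C)$ for any partial assignment $\tau$ of universal variables to $\{0,1\}$. *)

theory Defs
  imports Main
begin

datatype 'v literal = is_pos: Pos (var: 'v) | Neg (var: 'v)

type_synonym 'v clause = "'v literal set"

record 'v dqbf =
  universals :: "'v set"
  existentials :: "'v set"
  deps :: "'v \<Rightarrow> 'v set"
  matrix :: "'v clause set"

text \<open>
  Finiteness of the matrix and of its clauses follows from the finiteness of the set of variables.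
  The values of \<open>deps\<close> outside the existential variables are junk and are never constrained.
\<close>

definition wf_dqbf :: "'v dqbf \<Rightarrow> bool" where
  "wf_dqbf \<Phi> \<longleftrightarrow>
     finite (universals \<Phi>) \<and> finite (existentials \<Phi>) \<and>
     universals \<Phi> \<inter> existentials \<Phi> = {} \<and>
     (\<forall>x \<in> existentials \<Phi>. deps \<Phi> x \<subseteq> universals \<Phi>) \<and>
     (\<forall>C \<in> matrix \<Phi>. var ` C \<subseteq> universals \<Phi> \<union> existentials \<Phi>)"

text \<open>
  A partial assignment is a map \<open>'v \<rightharpoonup> bool\<close>; an element of \<open>{0,1}\<^sup>S\<close> is a map with domain \<open>S\<close>.
\<close>

definition lit_true :: "('v \<rightharpoonup> bool) \<Rightarrow> 'v literal \<Rightarrow> bool" where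
  "lit_true \<beta> l \<longleftrightarrow> \<beta> (var l) = Some (is_pos l)"

definition cnf_true :: "('v \<rightharpoonup> bool) \<Rightarrow> 'v clause set \<Rightarrow> bool" where
  "cnf_true \<beta> \<psi> \<longleftrightarrow> (\<forall>C \<in> \<psi>. \<exists>l \<in> C. lit_true \<beta> l)"

text \<open>
  A Skolem function \<open>f x\<close> is only ever applied to maps with domain \<open>deps \<Phi> x\<close>; its values on other
  maps are irrelevant.
\<close>

definition skolem_extend ::
    "'v dqbf \<Rightarrow> ('v \<Rightarrow> ('v \<rightharpoonup> bool) \<Rightarrow> bool) \<Rightarrow> ('v \<rightharpoonup> bool) \<Rightarrow> ('v \<rightharpoonup> bool)" where
  "skolem_extend \<Phi> f \<alpha> =
     (\<lambda>v. if v \<in> existentials \<Phi> then Some (f v (\<alpha> |` deps \<Phi> v)) else \<alpha> v)"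

definition dqbf_true :: "'v dqbf \<Rightarrow> bool" where
  "dqbf_true \<Phi> \<longleftrightarrow>
     (\<exists>f. \<forall>\<alpha>. dom \<alpha> = universals \<Phi> \<longrightarrow> cnf_true (skolem_extend \<Phi> f \<alpha>) (matrix \<Phi>))"

abbreviation dqbf_false :: "'v dqbf \<Rightarrow> bool" where
  "dqbf_false \<Phi> \<equiv> \<not> dqbf_true \<Phi>"

definition tautological :: "'v clause \<Rightarrow> bool" where
  "tautological C \<longleftrightarrow> (\<exists>v. Pos v \<in> C \<and> Neg v \<in> C)"

type_synonym 'v ann_literal = "'v literal \<times> ('v \<rightharpoonup> bool)"
type_synonym 'v ann_clause = "'v ann_literal set"

definition restrict :: "'v dqbf \<Rightarrow> 'v \<Rightarrow> ('v \<rightharpoonup> bool) \<Rightarrow> ('v \<rightharpoonup> bool)" where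
  "restrict \<Phi> x \<tau> = \<tau> |` deps \<Phi> x"

text \<open>
  In \<open>\<tau> ++ \<xi>\<close> the right operand takes precedence: an existing annotation \<open>\<xi>\<close> is extended by \<open>\<tau>\<close>,
  never overwritten.
\<close>

definition instantiate :: "'v dqbf \<Rightarrow> ('v \<rightharpoonup> bool) \<Rightarrow> 'v ann_clause \<Rightarrow> 'v ann_clause" where
  "instantiate \<Phi> \<tau> C = {(l, restrict \<Phi> (var l) (\<tau> ++ \<xi>)) | l \<xi>. (l, \<xi>) \<in> C}"

text \<open>
  The assignment falsifying the universal literals of \<open>C\<close>; the order of the case distinction is
  immaterial for non-tautological \<open>C\<close>.
\<close>

definition axiom_assignment :: "'v dqbf \<Rightarrow> 'v clause \<Rightarrow> ('v \<rightharpoonup> bool)" where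
  "axiom_assignment \<Phi> C =
     (\<lambda>u. if u \<in> universals \<Phi> \<and> Pos u \<in> C then Some False
          else if u \<in> universals \<Phi> \<and> Neg u \<in> C then Some True
          else None)"

inductive d_ir_calc :: "'v dqbf \<Rightarrow> 'v ann_clause \<Rightarrow> bool" for \<Phi> where
  Axiom:
    "C \<in> matrix \<Phi> \<Longrightarrow> \<not> tautological C \<Longrightarrow>
     d_ir_calc \<Phi> {(l, restrict \<Phi> (var l) (axiom_assignment \<Phi> C)) | l. l \<in> C \<and> var l \<in> existentials \<Phi>}"
| Resolution:
    "d_ir_calc \<Phi> ({(Pos x, \<tau>)} \<union> C\<^sub>1) \<Longrightarrow> d_ir_calc \<Phi> ({(Neg x, \<tau>)} \<union> C\<^sub>2) \<Longrightarrow>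
     d_ir_calc \<Phi> (C\<^sub>1 \<union> C\<^sub>2)"
| Instantiation:
    "d_ir_calc \<Phi> C \<Longrightarrow> dom \<tau> \<subseteq> universals \<Phi> \<Longrightarrow> d_ir_calc \<Phi> (instantiate \<Phi> \<tau> C)"

end

theory Submission
  imports Defs
begin

text \<open>
  Take as propositional atoms the pairs of an existential variable \<open>x\<close> and a total assignment of its
  dependency set. A valuation of the atoms is a choice of Skolem functions, so if \<open>\<Phi>\<close> is false then
  every valuation, together with some total universal assignment \<open>\<alpha>\<close>, falsifies a matrix clause \<open>C\<close>.
  As \<open>\<alpha>\<close> extends the axiom assignment of \<open>C\<close>, instantiating the axiom clause of \<open>C\<close> by \<open>\<alpha>\<close> gives a
  derivable clause over the atoms that the valuation falsifies. Propositional resolution is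
  refutationally complete on the finitely many atoms.
\<close>

text \<open>The type of annotations stays abstract: for propositional resolution an annotation is
  only part of the name of an atom.\<close>

definition falsified :: "('v \<times> 'a \<Rightarrow> bool) \<Rightarrow> ('v literal \<times> 'a) set \<Rightarrow> bool" where
  "falsified v C \<longleftrightarrow> (\<forall>(l, \<tau>) \<in> C. v (var l, \<tau>) \<noteq> is_pos l)"

definition atoms :: "('v literal \<times> 'a) set \<Rightarrow> ('v \<times> 'a) set" where
  "atoms C = map_prod var id ` C"

text \<open>Of the two literals on \<open>(x, \<tau>)\<close>, only the one excluded here is false
  when that atom has value \<open>b\<close>. So the clause does not mention the atom, and its value
  does not matter.\<close>

lemma falsified_update:
  assumes "falsified (v((x, \<tau>) := b)) C" and "(if b then Neg x else Pos x, \<tau>) \<notin> C"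
  shows "falsified v C \<and> (x, \<tau>) \<notin> atoms C"
proof -
  have "(var l, \<sigma>) \<noteq> (x, \<tau>) \<and> v (var l, \<sigma>) \<noteq> is_pos l" if "(l, \<sigma>) \<in> C" for l \<sigma>
    using assms that by (cases l) (fastforce simp: falsified_def split: if_splits)+
  then show ?thesis
    by (force simp: falsified_def atoms_def)
qed

text \<open>Induction on \<open>A\<close> eliminates one atom at a time. Of two clauses falsified
  when the atom is false and when it is true, either one avoids the atom or their resolvent on it
  does. With no atoms left, only the empty clause remains.\<close>

lemma resolution_refutation_complete:
  assumes "finite A"
    and resolve: "\<And>x \<tau> C D. {(Pos x, \<tau>)} \<union> C \<in> S \<Longrightarrow> {(Neg x, \<tau>)} \<union> D \<in> S \<Longrightarrow> C \<union> D \<in> S"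
    and "\<And>v. \<exists>C \<in> S. atoms C \<subseteq> A \<and> falsified v C"
  shows "{} \<in> S"
  using assms(1,3)
proof (induction A)
  case empty
  then show ?case
    by (auto simp: atoms_def)
next
  case (insert a A)
  obtain x \<tau> where a: "a = (x, \<tau>)"
    by fastforce
  have "\<exists>E \<in> S. atoms E \<subseteq> A \<and> falsified v E" for v
  proof -
    obtain C where C: "C \<in> S" "atoms C \<subseteq> insert a A" "falsified (v(a := False)) C"
      using insert.prems by blast
    obtain D where D: "D \<in> S" "atoms D \<subseteq> insert a A" "falsified (v(a := True)) D"
      using insert.prems by blast
    show ?thesis
    proof (cases "(Pos x, \<tau>) \<in> C \<and> (Neg x, \<tau>) \<in> D")
      case False
      then consider "(Pos x, \<tau>) \<notin> C" | "(Neg x, \<tau>) \<notin> D"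
        by blast
      then show ?thesis
      proof cases
        case 1
        then have "falsified v C \<and> a \<notin> atoms C"
          using falsified_update[of v x \<tau> False C] C(3) a by simp
        then show ?thesis
          using C(1,2) by blast
      next
        case 2
        then have "falsified v D \<and> a \<notin> atoms D"
          using falsified_update[of v x \<tau> True D] D(3) a by simp
        then show ?thesis
          using D(1,2) by blast
      qed
    next
      case True
      \<comment> \<open>Deleting the pivots makes sure that neither side of the resolvent still
        contains \<open>a\<close>.\<close>
      let ?C = "C - {(Pos x, \<tau>)}" and ?D = "D - {(Neg x, \<tau>)}"
      have "?C \<union> ?D \<in> S"
        using True C(1) D(1) resolve[of x \<tau> ?C ?D] by (simp add: insert_absorb)
      moreover have "falsified v ?C \<and> a \<notin> atoms ?C"
        using falsified_update[of v x \<tau> False ?C] C(3) a by (auto simp: falsified_def)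
      moreover have "falsified v ?D \<and> a \<notin> atoms ?D"
        using falsified_update[of v x \<tau> True ?D] D(3) a by (auto simp: falsified_def)
      moreover have "atoms (?C \<union> ?D) \<subseteq> insert a A"
        using C(2) D(2) by (auto simp: atoms_def)
      ultimately show ?thesis
        by (intro bexI[of _ "?C \<union> ?D"]) (auto simp: falsified_def atoms_def)
    qed
  qed
  then show ?case
    by (rule insert.IH)
qed

text \<open>On a universal variable of \<open>C\<close>, falsifying its literal leaves just one
  possible value, and \<alpha> is defined there.\<close>

lemma axiom_assignment_le:
  assumes "dom \<alpha> = universals \<Phi>"
    and "\<And>l. l \<in> C \<Longrightarrow> var l \<in> universals \<Phi> \<Longrightarrow> \<not> lit_true \<alpha> l"
  shows "axiom_assignment \<Phi> C \<subseteq>\<^sub>m \<alpha>"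
  unfolding map_le_def
proof
  fix u
  assume "u \<in> dom (axiom_assignment \<Phi> C)"
  then have "u \<in> universals \<Phi>" "Pos u \<in> C \<or> Neg u \<in> C"
    by (auto simp: axiom_assignment_def split: if_splits)
  moreover from this(1) obtain b where "\<alpha> u = Some b"
    using assms(1) by blast
  ultimately show "axiom_assignment \<Phi> C u = \<alpha> u"
    using assms(2)[of "Pos u"] assms(2)[of "Neg u"]
    by (auto simp: axiom_assignment_def lit_true_def)
qed

lemma d_ir_calc_ground:
  assumes "C \<in> matrix \<Phi>" "\<not> tautological C" "dom \<alpha> = universals \<Phi>"
    and "\<And>l. l \<in> C \<Longrightarrow> var l \<in> universals \<Phi> \<Longrightarrow> \<not> lit_true \<alpha> l"
  shows "d_ir_calc \<Phi> {(l, restrict \<Phi> (var l) \<alpha>) | l. l \<in> C \<and> var l \<in> existentials \<Phi>}"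
proof -
  let ?\<tau> = "axiom_assignment \<Phi> C"
  have "restrict \<Phi> x (\<alpha> ++ restrict \<Phi> x ?\<tau>) = restrict \<Phi> x \<alpha>" for x
  proof -
    \<comment> \<open>The old annotation takes precedence in \<open>++\<close>, but it is a submap
      of \<alpha> and so overwrites nothing.\<close>
    have "\<alpha> ++ restrict \<Phi> x ?\<tau> = \<alpha>"
      using axiom_assignment_le[OF assms(3,4)]
      by (auto simp: fun_eq_iff map_add_def restrict_def restrict_map_def map_le_def dom_def
          split: option.split)
    then show ?thesis
      by simp
  qed
  then have "instantiate \<Phi> \<alpha>
      {(l, restrict \<Phi> (var l) ?\<tau>) | l. l \<in> C \<and> var l \<in> existentials \<Phi>} =
      {(l, restrict \<Phi> (var l) \<alpha>) | l. l \<in> C \<and> var l \<in> existentials \<Phi>}"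
    by (auto simp: instantiate_def)
  then show ?thesis
    using Instantiation[OF Axiom[OF assms(1,2)], of \<alpha>] assms(3) by simp
qed

theorem theorem2:
  fixes \<Phi> :: "'v dqbf"
  assumes "wf_dqbf \<Phi>"
    and "dqbf_false \<Phi>"
  shows "d_ir_calc \<Phi> {}"
proof -
  \<comment> \<open>The bound on \<open>ran\<close> gives the set the form expected by
    \<open>finite_set_of_finite_maps\<close>.\<close>
  let ?A = "(\<lambda>(x, \<alpha>). (x, restrict \<Phi> x \<alpha>)) `
    (existentials \<Phi> \<times> {\<alpha>. dom \<alpha> = universals \<Phi> \<and> ran \<alpha> \<subseteq> UNIV})"
  have "finite ?A"
    using assms(1) unfolding wf_dqbf_def
    by (intro finite_imageI finite_cartesian_product finite_set_of_finite_maps) auto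
  moreover have "\<exists>D \<in> Collect (d_ir_calc \<Phi>). atoms D \<subseteq> ?A \<and> falsified v D" for v
  proof -
    let ?ext = "skolem_extend \<Phi> (\<lambda>x \<sigma>. v (x, \<sigma>))"
    obtain \<alpha> C where \<alpha>: "dom \<alpha> = universals \<Phi>" and C: "C \<in> matrix \<Phi>"
      and unsat: "\<And>l. l \<in> C \<Longrightarrow> \<not> lit_true (?ext \<alpha>) l"
      using assms(2) unfolding dqbf_true_def cnf_true_def by meson
    \<comment> \<open>Every variable of \<open>C\<close> gets a value under the extension of
      \<alpha>, so one of two complementary literals in \<open>C\<close> would be true.\<close>
    have vars: "var l \<in> universals \<Phi> \<union> existentials \<Phi>" if "l \<in> C" for l
      using assms(1) C that unfolding wf_dqbf_def by blast
    have "\<not> tautological C"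
    proof
      assume "tautological C"
      then obtain u where u: "Pos u \<in> C" "Neg u \<in> C"
        by (auto simp: tautological_def)
      moreover have "u \<in> dom (?ext \<alpha>)"
        using vars[OF u(1)] \<alpha>[symmetric] by (auto simp: skolem_extend_def)
      ultimately show False
        using unsat[of "Pos u"] unsat[of "Neg u"] by (auto simp: lit_true_def)
    qed
    moreover have "\<not> lit_true \<alpha> l" if "l \<in> C" "var l \<in> universals \<Phi>" for l
    proof -
      \<comment> \<open>By disjointness, the Skolem extension agrees with \<alpha> on universal
        variables.\<close>
      have "var l \<notin> existentials \<Phi>"
        using assms(1) that(2) by (auto simp: wf_dqbf_def)
      then show ?thesis
        using unsat[OF that(1)] by (simp add: lit_true_def skolem_extend_def)
    qed
    ultimately have "d_ir_calc \<Phi>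
        {(l, restrict \<Phi> (var l) \<alpha>) | l. l \<in> C \<and> var l \<in> existentials \<Phi>}" (is "d_ir_calc \<Phi> ?D")
      using d_ir_calc_ground C \<alpha> by blast
    moreover have "atoms ?D \<subseteq> ?A"
      using \<alpha> by (auto simp: atoms_def)
    \<comment> \<open>The Skolem function of \<open>x\<close> is applied to exactly the annotation
      \<open>restrict \<Phi> x \<alpha>\<close>, so the value of \<open>x\<close> is that of its
      atom under \<open>v\<close>.\<close>
    moreover have "v (var l, restrict \<Phi> (var l) \<alpha>) \<noteq> is_pos l"
      if "l \<in> C" "var l \<in> existentials \<Phi>" for l
      using unsat[OF that(1)] that(2)
      by (simp add: lit_true_def skolem_extend_def restrict_def)
    then have "falsified v ?D"
      by (auto simp: falsified_def)
    ultimately show ?thesis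
      by blast
  qed
  moreover have "C \<union> D \<in> Collect (d_ir_calc \<Phi>)"
    if "{(Pos x, \<tau>)} \<union> C \<in> Collect (d_ir_calc \<Phi>)"
      "{(Neg x, \<tau>)} \<union> D \<in> Collect (d_ir_calc \<Phi>)" for x \<tau> C D
    using Resolution[of \<Phi> x \<tau> C D] that by simp
  ultimately have "{} \<in> Collect (d_ir_calc \<Phi>)"
    using resolution_refutation_complete[of ?A "Collect (d_ir_calc \<Phi>)"] by presburger
  then show ?thesis
    by simp
qed

end
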